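(* Let $n\ge2$ and let $\lambda_1,\dots,\lambda_n,\mu$ be positive real numbers. The $n$-tuple $(M_{z_1},\dots,M_{z_n})$ of multiplication operators by the coordinate functions acting on the Hilbert space $\mathbb A^{(\lambda_1,\mu)}\otimes\mathbb A^{(\lambda_2)}\otimes\cdots\otimes\mathbb A^{(\lambda_n)}$ is not homogeneous under the action of $\mathrm{Aut}(\mathbb D^n)$.
   Context: $\mathbb D$ is the open unit disc; $\mathrm{Aut}(\mathbb D^n)$ is the group of biholomorphic automorphisms of $\mathbb D^n$. A commuting $n$-tuple $\boldsymbol T$ of bounded operators on a complex separable Hilbert space is homogeneous with respect to $\mathrm{Aut}(\mathbb D^n)$ if its joint spectrum lies in $\overline{\mathbb D}^n$ and $g(\boldsymbol T)$ is (simultaneously) unitarily equivalent to $\boldsymbol T$ for all $g\in\mathrm{Aut}(\mathbb D^n)$. $\mathbb A^{(\lambda)}$ is the Hilbert space of holomorphic functions on $\mathbb D$ with reproducing kernel $(1-z\bar w)^{-\lambda}$; $\mathbb A^{(\lambda,\mu)}$ is the Hilbert space of $\mathbb C^2$-valued holomorphic functions on $\mathbb D$ with reproducing kernel $$\begin{pmatrix}\frac{1}{(1-z\bar w)^{\lambda}}&\frac{z}{(1-z\bar w)^{\lambda+1}}\\ \frac{\bar w}{(1-z\bar w)^{\lambda+1}}&\frac{\frac1\lambda+\mu+z\bar w}{(1-z\bar w)^{\lambda+2}}\end{pmatrix}.$$ The tensor product is viewed as a space of $\mathbb C^2$-valued holomorphic functions on $\mathbb D^n$ whose reproducing kernel is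 the product of the kernels of the factors, the $i$-th in the variables $(z_i,w_i)$. *)

theory Defs
  imports "HOL-Analysis.Analysis" "HOL-Library.Function_Algebras"
begin

section \<open>The polydisc and its automorphisms\<close>

definition polydisc :: "(complex^'n) set" where
  "polydisc = {z. \<forall>i. norm (z $ i) < 1}"

definition closed_polydisc :: "(complex^'n) set" where
  "closed_polydisc = {z. \<forall>i. norm (z $ i) \<le> 1}"

text \<open>Holomorphy in several variables on an open set: Frechet differentiability with
  complex-linear derivative.\<close>

definition sv_holomorphic_on :: "(complex^'n \<Rightarrow> complex^'m) \<Rightarrow> (complex^'n) set \<Rightarrow> bool"
    (infixl "sv'_holomorphic'_on" 50) where
  "f sv_holomorphic_on S \<longleftrightarrow>
     (\<forall>z\<in>S. \<exists>D. (f has_derivative D) (at z) \<and> (\<forall>c v. D (c *s v) = c *s D v))"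

text \<open>Only the restriction of \<open>g\<close> to the polydisc matters.\<close>

definition aut_polydisc :: "(complex^'n \<Rightarrow> complex^'n) set" where
  "aut_polydisc = {g. bij_betw g polydisc polydisc \<and> g sv_holomorphic_on polydisc \<and>
                      inv_into polydisc g sv_holomorphic_on polydisc}"


section \<open>Commuting tuples of operators on a complex Hilbert space\<close>

text \<open>A Hilbert space is a subset \<open>H\<close> of an ambient complex vector space together with an
  inner product \<open>ip\<close>, linear in the first argument. Operators are functions on the ambient
  type of which only the restriction to \<open>H\<close> matters; an \<open>n\<close>-tuple is a family indexed by a
  finite linearly ordered type.\<close>

locale complex_hilbert_space = vector_space scale
  for scale :: "complex \<Rightarrow> 'v::ab_group_add \<Rightarrow> 'v" +
  fixes H :: "'v set" and ip :: "'v \<Rightarrow> 'v \<Rightarrow> complex"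
  assumes subspace_H: "subspace H"
    and ip_add: "\<lbrakk>x \<in> H; y \<in> H; z \<in> H\<rbrakk> \<Longrightarrow> ip (x + y) z = ip x z + ip y z"
    and ip_scale: "\<lbrakk>x \<in> H; y \<in> H\<rbrakk> \<Longrightarrow> ip (scale c x) y = c * ip x y"
    and ip_cnj: "\<lbrakk>x \<in> H; y \<in> H\<rbrakk> \<Longrightarrow> ip y x = cnj (ip x y)"
    and ip_pos: "\<lbrakk>x \<in> H; x \<noteq> 0\<rbrakk> \<Longrightarrow> 0 < Re (ip x x)"
    and complete_H: "\<lbrakk>\<And>k. X k \<in> H;
        \<And>e. 0 < e \<Longrightarrow> \<exists>N. \<forall>k\<ge>N. \<forall>l\<ge>N. sqrt (Re (ip (X k - X l) (X k - X l))) < e\<rbrakk>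
      \<Longrightarrow> \<exists>x\<in>H. (\<lambda>k. sqrt (Re (ip (X k - x) (X k - x)))) \<longlonglongrightarrow> 0"
begin

definition hnorm :: "'v \<Rightarrow> real" where
  "hnorm x = sqrt (Re (ip x x))"

definition bounded_operator :: "('v \<Rightarrow> 'v) \<Rightarrow> bool" where
  "bounded_operator A \<longleftrightarrow>
     (\<forall>x\<in>H. A x \<in> H) \<and>
     (\<forall>x\<in>H. \<forall>y\<in>H. A (x + y) = A x + A y) \<and>
     (\<forall>c. \<forall>x\<in>H. A (scale c x) = scale c (A x)) \<and>
     (\<exists>C. \<forall>x\<in>H. hnorm (A x) \<le> C * hnorm x)"

definition commuting_tuple :: "('n::{finite,linorder} \<Rightarrow> 'v \<Rightarrow> 'v) \<Rightarrow> bool" where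
  "commuting_tuple T \<longleftrightarrow>
     (\<forall>i. bounded_operator (T i)) \<and> (\<forall>i j. \<forall>x\<in>H. T i (T j x) = T j (T i x))"

text \<open>The coboundary of the Koszul complex \<open>\<Lambda>(\<complex>\<^sup>n) \<otimes> H\<close>, mapping \<open>x e\<^sub>I\<close> to the sum of the
  \<open>T\<^sub>i x (e\<^sub>i \<and> e\<^sub>I)\<close>. A family \<open>\<eta>\<close> indexed by sets stands for the sum of the
  \<open>\<eta> I e\<^sub>I\<close>, all degrees together.\<close>

definition koszul ::
    "('n::{finite,linorder} \<Rightarrow> 'v \<Rightarrow> 'v) \<Rightarrow> ('n set \<Rightarrow> 'v) \<Rightarrow> 'n set \<Rightarrow> 'v" where
  "koszul T \<eta> J = (\<Sum>i\<in>J. scale ((-1) ^ card {j\<in>J. j < i}) (T i (\<eta> (J - {i}))))"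

text \<open>The Taylor joint spectrum: the points \<open>\<zeta>\<close> for which the Koszul complex of \<open>T - \<zeta>\<close> is
  not exact. As the coboundary is homogeneous of degree one, exactness in every degree is
  the same as kernel = range on the whole complex.\<close>

definition joint_spectrum :: "('n::{finite,linorder} \<Rightarrow> 'v \<Rightarrow> 'v) \<Rightarrow> (complex^'n::{finite,linorder}) set" where
  "joint_spectrum T =
     {\<zeta>. let d = koszul (\<lambda>i x. T i x - scale (\<zeta> $ i) x) in
          \<exists>\<eta>. (\<forall>I. \<eta> I \<in> H) \<and> (\<forall>J. d \<eta> J = 0) \<and>
              \<not> (\<exists>\<theta>. (\<forall>I. \<theta> I \<in> H) \<and> (\<forall>J. \<eta> J = d \<theta> J))}"

definition op_monomial ::
    "('n::{finite,linorder} \<Rightarrow> 'v \<Rightarrow> 'v) \<Rightarrow> ('n \<Rightarrow> nat) \<Rightarrow> 'v \<Rightarrow> 'v" where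
  "op_monomial T \<alpha> = foldr (\<lambda>i. (\<circ>) (T i ^^ \<alpha> i)) (sorted_list_of_set UNIV) id"

text \<open>\<open>S = f(T)\<close> in the holomorphic functional calculus, for \<open>f\<close> extending holomorphically to a
  neighbourhood of the closed polydisc, in which the joint spectrum of \<open>T\<close> lies. Such an \<open>f\<close>
  has a power series converging on a polydisc of radius \<open>R > 1\<close>, and \<open>f(T)\<close> is
  the sum in operator norm of that series evaluated at \<open>T\<close>.\<close>

definition functional_calculus ::
    "(complex^'n::{finite,linorder} \<Rightarrow> complex) \<Rightarrow> ('n::{finite,linorder} \<Rightarrow> 'v \<Rightarrow> 'v) \<Rightarrow> ('v \<Rightarrow> 'v) \<Rightarrow> bool" where
  "functional_calculus f T S \<longleftrightarrow>
     (\<forall>x\<in>H. S x \<in> H) \<and>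
     (\<exists>(a :: ('n \<Rightarrow> nat) \<Rightarrow> complex) R. 1 < R \<and>
        (\<forall>z. (\<forall>i. norm (z $ i) < R) \<longrightarrow> (\<lambda>\<alpha>. a \<alpha> * (\<Prod>i\<in>UNIV. (z $ i) ^ \<alpha> i)) summable_on UNIV) \<and>
        (\<forall>z\<in>polydisc. ((\<lambda>\<alpha>. a \<alpha> * (\<Prod>i\<in>UNIV. (z $ i) ^ \<alpha> i)) has_sum f z) UNIV) \<and>
        (\<forall>e>0. \<exists>F. finite F \<and> (\<forall>G. finite G \<and> F \<subseteq> G \<longrightarrow>
           (\<forall>x\<in>H. hnorm ((\<Sum>\<alpha>\<in>G. scale (a \<alpha>) (op_monomial T \<alpha> x)) - S x) \<le> e * hnorm x))))"

definition unitarily_equivalent ::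
    "('n::{finite,linorder} \<Rightarrow> 'v \<Rightarrow> 'v) \<Rightarrow> ('n \<Rightarrow> 'v \<Rightarrow> 'v) \<Rightarrow> bool" where
  "unitarily_equivalent S T \<longleftrightarrow>
     (\<exists>U. bounded_operator U \<and> bij_betw U H H \<and>
          (\<forall>x\<in>H. \<forall>y\<in>H. ip (U x) (U y) = ip x y) \<and>
          (\<forall>i. \<forall>x\<in>H. U (S i x) = T i (U x)))"

definition homogeneous_tuple :: "('n::{finite,linorder} \<Rightarrow> 'v \<Rightarrow> 'v) \<Rightarrow> bool" where
  "homogeneous_tuple T \<longleftrightarrow>
     commuting_tuple T \<and> joint_spectrum T \<subseteq> closed_polydisc \<and>
     (\<forall>g\<in>aut_polydisc. \<exists>S. (\<forall>i. functional_calculus (\<lambda>z. g z $ i) T (S i)) \<and>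
                          unitarily_equivalent S T)"

end


section \<open>Hilbert spaces of vector-valued holomorphic functions\<close>

definition fscale :: "complex \<Rightarrow> ('a \<Rightarrow> complex^'m) \<Rightarrow> 'a \<Rightarrow> complex^'m" where
  "fscale c f = (\<lambda>z. c *s f z)"

text \<open>\<open>(H, ip)\<close> is the Hilbert space of \<open>\<complex>\<^sup>m\<close>-valued holomorphic functions on the polydisc
  with reproducing kernel \<open>K\<close>. Functions on the polydisc are represented by their
  extension by zero.\<close>

definition reproducing_kernel_space ::
    "(complex^'n \<Rightarrow> complex^'n \<Rightarrow> complex^'m^'m) \<Rightarrow>
     (complex^'n \<Rightarrow> complex^'m) set \<Rightarrow>
     ((complex^'n \<Rightarrow> complex^'m) \<Rightarrow> (complex^'n \<Rightarrow> complex^'m) \<Rightarrow> complex) \<Rightarrow> bool" where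
  "reproducing_kernel_space K H ip \<longleftrightarrow>
     complex_hilbert_space fscale H ip \<and>
     (\<forall>f\<in>H. f sv_holomorphic_on polydisc \<and> (\<forall>z. z \<notin> polydisc \<longrightarrow> f z = 0)) \<and>
     (\<forall>w\<in>polydisc. \<forall>\<xi>.
        let k = (\<lambda>z. if z \<in> polydisc then K z w *v \<xi> else 0) in
          k \<in> H \<and> (\<forall>f\<in>H. ip f k = (\<Sum>j\<in>UNIV. f w $ j * cnj (\<xi> $ j))))"

text \<open>For \<open>z\<close>, \<open>w\<close> in the disc \<open>1 - z * cnj w\<close> has positive real part, so the principal branch
  is meant.\<close>

definition disc_kernel :: "real \<Rightarrow> complex \<Rightarrow> complex \<Rightarrow> complex" where
  "disc_kernel lam z w = 1 / (1 - z * cnj w) powr of_real lam"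

definition disc_kernel2 :: "real \<Rightarrow> real \<Rightarrow> complex \<Rightarrow> complex \<Rightarrow> complex^2^2" where
  "disc_kernel2 lam \<mu> z w = vector
     [vector [1 / (1 - z * cnj w) powr of_real lam,
              z / (1 - z * cnj w) powr of_real (lam + 1)],
      vector [cnj w / (1 - z * cnj w) powr of_real (lam + 1),
              (of_real (1 / lam + \<mu>) + z * cnj w) / (1 - z * cnj w) powr of_real (lam + 2)]]"

text \<open>The kernel of \<open>A\<^bsup>(\<lambda>1,\<mu>)\<^esup> \<otimes> A\<^bsup>(\<lambda>2)\<^esup> \<otimes> \<dots> \<otimes> A\<^bsup>(\<lambda>n)\<^esup>\<close>; the first index is the least element
  of the index type.\<close>

definition tensor_kernel ::
    "('n::{finite,linorder} \<Rightarrow> real) \<Rightarrow> real \<Rightarrow>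
     complex^'n::{finite,linorder} \<Rightarrow> complex^'n::{finite,linorder} \<Rightarrow> complex^2^2" where
  "tensor_kernel lam \<mu> z w =
     (let i1 = Min UNIV in
      \<chi> p q. disc_kernel2 (lam i1) \<mu> (z $ i1) (w $ i1) $ p $ q *
             (\<Prod>i\<in>UNIV - {i1}. disc_kernel (lam i) (z $ i) (w $ i)))"

definition coordinate_mult ::
    "'n \<Rightarrow> (complex^'n \<Rightarrow> complex^'m) \<Rightarrow> complex^'n \<Rightarrow> complex^'m" where
  "coordinate_mult i f = (\<lambda>z. (z $ i) *s f z)"

end

theory Submission
  imports Defs "HOL-Complex_Analysis.Conformal_Mappings"
begin

text \<open>
  The group of automorphisms of the polydisc contains the transposition of the first variable
  with another variable \<open>j\<close>. For this automorphism \<open>g\<close> the tuple \<open>g(T)\<close> is \<open>T\<close> with the two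
  operators \<open>T\<^sub>1\<close> and \<open>T\<^sub>j\<close> exchanged, so a homogeneous tuple would admit a unitary \<open>U\<close> with
  \<open>U T\<^sub>j = T\<^sub>1 U\<close>, \<open>U T\<^sub>1 = T\<^sub>j U\<close> and \<open>U T\<^sub>i = T\<^sub>i U\<close> otherwise. The first variable is the one that
  carries the vector-valued factor, and a unitary invariant tells it apart from the others.

  The invariant lives on the joint kernel \<open>E\<close> of the adjoints, that is, on the orthogonal complement
  of the ranges of all \<open>T\<^sub>i\<close>. Every such \<open>U\<close> preserves \<open>E\<close>, and \<open>E\<close> consists
  exactly of the kernel functions \<open>K(\<cdot>,0)\<xi>\<close> (\<open>adjoint_kernel_eq_kern_0\<close>): for small \<open>w\<close> the function
  \<open>K(\<cdot>,w)\<xi>\<close> is obtained from constant functions by multiplication with power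
  series in the single variables, hence differs from a combination of the \<open>K(\<cdot>,0)\<eta>\<close> by a limit of
  sums of elements of the ranges, and this determines an element of \<open>E\<close> near \<open>0\<close>.

  On \<open>E\<close> compare the forms \<open>\<langle>T\<^sub>i x, T\<^sub>i x\<rangle>\<close> and \<open>\<langle>x, x\<rangle>\<close>. For \<open>i = j\<close> the first is
  \<open>1/\<lambda>\<^sub>j\<close> times the second (\<open>norm_mult_kern_0_other_variable\<close>). If \<open>U\<close> existed, the form for \<open>i = 1\<close>
  would be the same multiple. Expanding \<open>K(\<cdot>,w)\<xi>\<close> in powers
  of the conjugate of \<open>w\<^sub>1\<close> and comparing coefficients gives linear equations for the norms of \<open>T\<^sub>1 K(\<cdot>,0)e\<^sub>1\<close> and
  \<open>T\<^sub>1 K(\<cdot>,0)e\<^sub>2\<close>. With \<open>\<kappa> = 1/\<lambda>\<^sub>1 + \<mu>\<close>, proportionality to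
  \<open>\<langle>x, x\<rangle>\<close> would force \<open>(\<lambda>\<^sub>1 + 1) \<kappa> = 1\<close>, which contradicts \<open>\<lambda>\<^sub>1 \<kappa> > 1\<close>
  (\<open>norm_relations_contradiction\<close>).
\<close>

section \<open>Hilbert space preliminaries\<close>

context complex_hilbert_space
begin

lemma zero_in_H: "0 \<in> H"
  and add_in_H: "x \<in> H \<Longrightarrow> y \<in> H \<Longrightarrow> x + y \<in> H"
  and scale_in_H: "x \<in> H \<Longrightarrow> scale c x \<in> H"
  and diff_in_H: "x \<in> H \<Longrightarrow> y \<in> H \<Longrightarrow> x - y \<in> H"
  and sum_in_H: "(\<And>k. k \<in> A \<Longrightarrow> X k \<in> H) \<Longrightarrow> sum X A \<in> H"
  using subspace_H by (auto intro: subspace_0 subspace_add subspace_scale subspace_diff subspace_sum)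

lemma ip_zero_left: "y \<in> H \<Longrightarrow> ip 0 y = 0"
  using ip_scale[of 0 y 0] zero_in_H by simp

lemma ip_diff_left: "x \<in> H \<Longrightarrow> y \<in> H \<Longrightarrow> z \<in> H \<Longrightarrow> ip (x - y) z = ip x z - ip y z"
  using ip_add[of "x - y" y z] diff_in_H by simp

lemma ip_sum_left:
  "(\<And>k. k \<in> A \<Longrightarrow> X k \<in> H) \<Longrightarrow> z \<in> H \<Longrightarrow> ip (sum X A) z = (\<Sum>k\<in>A. ip (X k) z)"
  by (induction A rule: infinite_finite_induct) (auto simp: ip_zero_left ip_add sum_in_H)

lemma ip_add_right: "x \<in> H \<Longrightarrow> y \<in> H \<Longrightarrow> z \<in> H \<Longrightarrow> ip z (x + y) = ip z x + ip z y"
  by (metis add_in_H ip_add ip_cnj complex_cnj_add)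

lemma ip_scale_right: "x \<in> H \<Longrightarrow> y \<in> H \<Longrightarrow> ip y (scale c x) = cnj c * ip y x"
  by (metis scale_in_H ip_scale ip_cnj complex_cnj_mult)

lemma ip_diff_right: "x \<in> H \<Longrightarrow> y \<in> H \<Longrightarrow> z \<in> H \<Longrightarrow> ip z (x - y) = ip z x - ip z y"
  by (metis diff_in_H ip_diff_left ip_cnj complex_cnj_diff)

lemma ip_self: "x \<in> H \<Longrightarrow> ip x x = of_real ((hnorm x)\<^sup>2)"
proof -
  assume x: "x \<in> H"
  have "Im (ip x x) = 0"
    using ip_cnj[OF x x] by (metis add.inverse_inverse complex_cnj cnj.sel(2) complex_surj equal_neg_zero)
  moreover have "0 \<le> Re (ip x x)"
    using ip_pos[OF x] ip_zero_left[OF zero_in_H] by (cases "x = 0") auto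
  ultimately show ?thesis
    by (simp add: hnorm_def complex_eq_iff)
qed

lemma hnorm_nonneg [simp]: "x \<in> H \<Longrightarrow> 0 \<le> hnorm x"
  using ip_pos[of x] ip_zero_left[OF zero_in_H] by (cases "x = 0") (auto simp: hnorm_def)

lemma hnorm_sq: "x \<in> H \<Longrightarrow> (hnorm x)\<^sup>2 = Re (ip x x)"
  by (simp add: ip_self)

lemma hnorm_eq_0: "x \<in> H \<Longrightarrow> hnorm x = 0 \<Longrightarrow> x = 0"
  using ip_pos[of x] by (force simp: hnorm_def)

lemma hnorm_scale: "x \<in> H \<Longrightarrow> hnorm (scale c x) = norm c * hnorm x"
proof -
  assume x: "x \<in> H"
  have "ip (scale c x) (scale c x) = c * cnj c * ip x x"
    using x by (simp add: ip_scale ip_scale_right scale_in_H mult_ac)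
  also have "\<dots> = of_real ((norm c * hnorm x)\<^sup>2)"
    using x by (simp add: ip_self power_mult_distrib complex_norm_square del: of_real_power)
  finally have "of_real ((hnorm (scale c x))\<^sup>2) = (of_real ((norm c * hnorm x)\<^sup>2) :: complex)"
    using x by (simp only: ip_self scale_in_H)
  hence "(hnorm (scale c x))\<^sup>2 = (norm c * hnorm x)\<^sup>2"
    by (simp only: of_real_eq_iff)
  thus ?thesis
    using x by (simp add: scale_in_H power2_eq_iff_nonneg)
qed

lemma Cauchy_Schwarz: "x \<in> H \<Longrightarrow> y \<in> H \<Longrightarrow> norm (ip x y) \<le> hnorm x * hnorm y"
proof (cases "y = 0")
  case True
  assume x: "x \<in> H"
  have "ip x 0 = 0"
    using x zero_in_H by (metis ip_cnj ip_zero_left complex_cnj_zero)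
  thus ?thesis using True x by (simp add: zero_in_H)
next
  case False
  assume x: "x \<in> H" and y: "y \<in> H"
  have pos: "0 < hnorm y" using y False hnorm_eq_0 hnorm_nonneg by (metis less_eq_real_def)
  define c where "c = ip x y / of_real ((hnorm y)\<^sup>2)"
  have z: "x - scale c y \<in> H" using x y by (simp add: diff_in_H scale_in_H)
  have "ip (x - scale c y) y = 0"
    using x y pos by (simp add: ip_diff_left ip_scale scale_in_H ip_self c_def)
  hence "ip (x - scale c y) (x - scale c y) = ip (x - scale c y) x"
    using x y z by (simp add: ip_diff_right[OF _ _ z] ip_scale_right scale_in_H)
  also have "\<dots> = ip x x - c * cnj (ip x y)"
    using x y by (simp add: ip_diff_left ip_scale scale_in_H flip: ip_cnj)
  also have "\<dots> = of_real ((hnorm x)\<^sup>2 - (norm (ip x y))\<^sup>2 / (hnorm y)\<^sup>2)"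
    using x unfolding ip_self[OF x] c_def by (simp add: complex_norm_square[symmetric] flip: of_real_power)
  finally have "0 \<le> (hnorm x)\<^sup>2 - (norm (ip x y))\<^sup>2 / (hnorm y)\<^sup>2"
    using z unfolding ip_self[OF z] of_real_eq_iff by (metis zero_le_power2)
  hence "(norm (ip x y))\<^sup>2 \<le> (hnorm x * hnorm y)\<^sup>2"
    using pos by (simp add: field_simps)
  thus ?thesis using x y by (simp add: power2_le_iff_abs_le)
qed

lemma hnorm_triangle: "x \<in> H \<Longrightarrow> y \<in> H \<Longrightarrow> hnorm (x + y) \<le> hnorm x + hnorm y"
proof -
  assume x: "x \<in> H" and y: "y \<in> H"
  have "(hnorm (x + y))\<^sup>2 = (hnorm x)\<^sup>2 + 2 * Re (ip x y) + (hnorm y)\<^sup>2"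
    using x y ip_cnj[OF x y] by (simp add: hnorm_sq add_in_H ip_add ip_add_right)
  also have "\<dots> \<le> (hnorm x)\<^sup>2 + 2 * (hnorm x * hnorm y) + (hnorm y)\<^sup>2"
    using Cauchy_Schwarz[OF x y] complex_Re_le_cmod[of "ip x y"] by simp
  also have "\<dots> = (hnorm x + hnorm y)\<^sup>2" by (simp add: power2_sum)
  finally show ?thesis using x y by (simp add: power2_le_iff_abs_le add_in_H)
qed

lemma hnorm_sum_le:
  "(\<And>k. k \<in> A \<Longrightarrow> X k \<in> H) \<Longrightarrow> hnorm (sum X A) \<le> (\<Sum>k\<in>A. hnorm (X k))"
proof (induction A rule: infinite_finite_induct)
  case (insert a A)
  thus ?case using hnorm_triangle[of "X a" "sum X A"] by (force simp: sum_in_H)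
qed (auto simp: hnorm_def ip_zero_left zero_in_H)

text \<open>The sum of an absolutely convergent series is characterised through its inner products: in a
  reproducing kernel space these include all point evaluations, which identify it as a function.\<close>
lemma absolutely_summable_weak_sum:
  assumes X: "\<And>k. X k \<in> H" and summ: "summable (\<lambda>k. hnorm (X k))"
  shows "\<exists>s\<in>H. \<forall>h\<in>H. (\<lambda>k. ip (X k) h) sums ip s h"
proof -
  let ?S = "\<lambda>n. \<Sum>k<n. X k"
  have S: "?S n \<in> H" for n using X by (simp add: sum_in_H)
  have tail: "hnorm (?S k - ?S l) \<le> norm (sum (\<lambda>k. hnorm (X k)) {min k l..<max k l})" for k l
  proof -
    have *: "?S n - ?S m = sum X {m..<n}" if "m \<le> n" for m n
      using that by (simp add: sum_diff_nat_ivl lessThan_atLeast0)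
    have **: "hnorm (sum X {m..<n}) \<le> norm (sum (\<lambda>k. hnorm (X k)) {m..<n})" for m n
      using hnorm_sum_le[of "{m..<n}" X] X by (simp add: abs_le_iff order_trans)
    have "hnorm (?S k - ?S l) = hnorm (sum X {min k l..<max k l})"
    proof (cases "l \<le> k")
      case True thus ?thesis using * by (simp add: min_def max_def)
    next
      case False
      hence "?S k - ?S l = scale (-1) (sum X {k..<l})"
        using *[of k l] by (simp add: scale_minus_left) (metis minus_diff_eq)
      hence "hnorm (?S k - ?S l) = hnorm (sum X {k..<l})"
        using X by (simp only: hnorm_scale sum_in_H) simp
      thus ?thesis using False by (simp add: min_def max_def)
    qed
    thus ?thesis using ** by simp
  qed
  have "\<exists>N. \<forall>k\<ge>N. \<forall>l\<ge>N. sqrt (Re (ip (?S k - ?S l) (?S k - ?S l))) < e" if "0 < e" for e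
  proof -
    obtain N where N: "\<And>m n. N \<le> m \<Longrightarrow> norm (sum (\<lambda>k. hnorm (X k)) {m..<n}) < e"
      using summ \<open>0 < e\<close> unfolding summable_Cauchy by meson
    have "hnorm (?S k - ?S l) < e" if "N \<le> k" "N \<le> l" for k l
      using tail[of k l] N[of "min k l" "max k l"] that by (simp add: min_def split: if_splits)
    thus ?thesis unfolding hnorm_def by blast
  qed
  then obtain s where s: "s \<in> H" and lim: "(\<lambda>k. hnorm (?S k - s)) \<longlonglongrightarrow> 0"
    using complete_H[of ?S] S unfolding hnorm_def by blast
  have "(\<lambda>k. ip (X k) h) sums ip s h" if h: "h \<in> H" for h
  proof -
    have "(\<lambda>n. hnorm (?S n - s) * hnorm h) \<longlonglongrightarrow> 0"
      using tendsto_mult_left_zero[OF lim] by simp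
    hence "(\<lambda>n. ip (?S n) h - ip s h) \<longlonglongrightarrow> 0"
      by (rule Lim_null_comparison[rotated])
         (use S s h Cauchy_Schwarz in \<open>simp flip: ip_diff_left add: diff_in_H\<close>)
    hence "(\<lambda>n. ip (?S n) h) \<longlonglongrightarrow> ip s h" by (simp add: LIM_zero_iff)
    thus ?thesis using X h by (simp add: sums_def ip_sum_left)
  qed
  thus ?thesis using s by blast
qed

text \<open>The vector \<open>s\<close> is \<open>\<phi>(b A) f\<close> for \<open>\<phi>(t) = \<Sum> c\<^sub>n t\<^sup>n\<close>. Because
  \<open>\<bar>b\<bar> C < 1\<close>, the norms of the terms are those of a power series at a point inside its disc of
  absolute convergence.\<close>
lemma operator_power_series:
  assumes A: "\<And>x. x \<in> H \<Longrightarrow> A x \<in> H" and bound: "\<And>x. x \<in> H \<Longrightarrow> hnorm (A x) \<le> C * hnorm x"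
    and C: "0 \<le> C" and conv: "\<And>t. norm t < 1 \<Longrightarrow> summable (\<lambda>n. c n * t ^ n)"
    and b: "norm b * C < 1" and f: "f \<in> H"
  shows "\<exists>s\<in>H. \<forall>h\<in>H. (\<lambda>n. c n * ip ((A ^^ n) f) h * b ^ n) sums ip s h"
proof -
  have An: "(A ^^ n) f \<in> H" for n by (induction n) (auto simp: f A)
  have bd: "hnorm ((A ^^ n) f) \<le> C ^ n * hnorm f" for n
  proof (induction n)
    case (Suc n)
    have "hnorm (A ((A ^^ n) f)) \<le> C * (C ^ n * hnorm f)"
      using bound[OF An, of n] mult_left_mono[OF Suc C] by linarith
    thus ?case by (simp add: mult_ac)
  qed simp
  define q where "q = norm b * C"
  have q: "0 \<le> q" "q < 1" using b C by (auto simp: q_def)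
  obtain t :: real where t: "q < t" "t < 1" using q dense by blast
  have "summable (\<lambda>n. c n * of_real t ^ n)" using conv[of "of_real t"] t q by simp
  hence "summable (\<lambda>n. norm (c n * of_real q ^ n))"
    by (rule powser_insidea) (use q t in simp)
  hence summ: "summable (\<lambda>n. norm (c n) * q ^ n * hnorm f)"
    using q by (simp add: norm_mult norm_power summable_mult2)
  let ?X = "\<lambda>n. scale (c n * b ^ n) ((A ^^ n) f)"
  have X: "?X n \<in> H" for n using An by (simp add: scale_in_H)
  have "summable (\<lambda>n. hnorm (?X n))"
  proof (rule summable_comparison_test[OF _ summ], intro exI[of _ 0] allI impI)
    fix n
    have "hnorm (?X n) \<le> norm (c n) * norm b ^ n * (C ^ n * hnorm f)"
      using mult_left_mono[OF bd, of "norm (c n) * norm b ^ n" n]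
      by (simp add: hnorm_scale An norm_mult norm_power)
    thus "norm (hnorm (?X n)) \<le> norm (c n) * q ^ n * hnorm f"
      using X by (simp add: q_def power_mult_distrib mult_ac)
  qed
  from absolutely_summable_weak_sum[OF X this] show ?thesis
    using An by (simp add: ip_scale mult_ac)
qed

end

section \<open>Powers of the Szego kernel and power series\<close>

lemma sums_imp_has_fps_expansion:
  fixes F :: "complex \<Rightarrow> complex"
  assumes "0 < r" and "\<And>w. norm w < r \<Longrightarrow> (\<lambda>n. a n * w ^ n) sums F w"
  shows "F has_fps_expansion Abs_fps a"
proof (rule has_fps_expansionI)
  show "eventually (\<lambda>w. (\<lambda>n. fps_nth (Abs_fps a) n * w ^ n) sums F w) (nhds 0)"
    using eventually_nhds_in_open[of "ball 0 r" "0::complex"] assms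
    by (auto elim!: eventually_mono)
qed

lemma has_fps_expansion_unique:
  fixes F G :: "complex fps"
  assumes "f has_fps_expansion F" "f has_fps_expansion G"
  shows "F = G"
  using assms[THEN fps_nth_fps_expansion] by (simp add: fps_eq_iff)

lemma has_fps_expansion_transform:
  fixes f :: "complex \<Rightarrow> complex"
  assumes "eventually (\<lambda>x. f x = g x) (nhds 0)" "g has_fps_expansion F"
  shows "f has_fps_expansion F"
  using assms by (auto simp: has_fps_expansion_def elim: eventually_elim2)

text \<open>In terms of this function \<open>disc_kernel lam z w\<close> is \<open>szego_power lam (cnj w * z)\<close>; its Taylor
  coefficients follow from the general binomial series.\<close>
definition szego_power :: "real \<Rightarrow> complex \<Rightarrow> complex" where
  "szego_power lam s = 1 / (1 - s) powr of_real lam"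

definition szego_coeff :: "real \<Rightarrow> nat \<Rightarrow> complex" where
  "szego_coeff lam n = (- of_real lam gchoose n) * (- 1) ^ n"

lemma szego_power_sums: "norm s < 1 \<Longrightarrow> (\<lambda>n. szego_coeff lam n * s ^ n) sums szego_power lam s"
  using gen_binomial_complex[of "- s" "- of_real lam"]
  by (simp add: szego_power_def szego_coeff_def powr_minus_divide mult.assoc flip: power_mult_distrib)

lemma szego_coeff_simps [simp]: "szego_coeff lam 0 = 1" "szego_coeff lam (Suc 0) = of_real lam"
  "szego_coeff lam 2 = of_real (lam * (lam + 1)) / 2"
  by (simp_all add: szego_coeff_def gbinomial_Suc_rec numeral_2_eq_2 field_simps gbinomial_prod_rev)

lemma szego_power_0 [simp]: "szego_power l 0 = 1"
  by (simp add: szego_power_def)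

section \<open>Holomorphic functions and automorphisms on the polydisc\<close>

lemma open_polydisc: "open (polydisc :: (complex^'n) set)"
proof -
  have eq: "(polydisc :: (complex^'n) set) = (\<Inter>i. {z :: complex^'n. norm (z $ i) < 1})"
    by (auto simp: polydisc_def)
  have "open {z :: complex^'n. norm (z $ i) < 1}" for i
    by (intro open_Collect_less continuous_intros)
  thus ?thesis unfolding eq by (intro open_INT) auto
qed

lemma zero_in_polydisc: "0 \<in> polydisc"
  by (simp add: polydisc_def)

lemma axis_in_polydisc: "norm b < 1 \<Longrightarrow> axis i b \<in> polydisc"
  by (simp add: polydisc_def axis_def)

lemma sv_holomorphic_on_line:
  fixes f :: "complex^'n \<Rightarrow> complex^'m"
  assumes f: "f sv_holomorphic_on polydisc" and S: "\<And>t. t \<in> S \<Longrightarrow> t *s w \<in> polydisc"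
  shows "(\<lambda>t. f (t *s w) $ j) holomorphic_on S"
  unfolding holomorphic_on_def
proof
  fix t assume "t \<in> S"
  then obtain D where D: "(f has_derivative D) (at (t *s w))" and lin: "\<And>c v. D (c *s v) = c *s D v"
    using f S unfolding sv_holomorphic_on_def by blast
  have "linear (\<lambda>t. t *s w)"
    by (rule linearI) (auto simp: vec_eq_iff algebra_simps)
  hence "bounded_linear (\<lambda>t. t *s w)"
    by (simp add: linear_conv_bounded_linear)
  hence "((\<lambda>t. t *s w) has_derivative (\<lambda>t. t *s w)) (at t within S)"
    by (rule bounded_linear_imp_has_derivative)
  from has_derivative_compose[OF this D] have "((\<lambda>t. f (t *s w)) has_derivative (\<lambda>h. D (h *s w))) (at t within S)" .
  hence "((\<lambda>t. f (t *s w) $ j) has_derivative (\<lambda>h. D (h *s w) $ j)) (at t within S)"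
    by (rule bounded_linear.has_derivative[OF bounded_linear_vec_nth])
  hence "((\<lambda>t. f (t *s w) $ j) has_field_derivative (D w $ j)) (at t within S)"
    by (simp add: has_field_derivative_def lin mult.commute[of _ "D w $ j"])
  thus "(\<lambda>t. f (t *s w) $ j) field_differentiable at t within S"
    unfolding field_differentiable_def by blast
qed

text \<open>The identity theorem of one variable is applied along the complex line through \<open>0\<close> and \<open>w\<close>.\<close>
lemma sv_holomorphic_eq_0:
  fixes f :: "complex^'n \<Rightarrow> complex^'m"
  assumes f: "f sv_holomorphic_on polydisc" and r: "0 < r"
    and zero: "\<And>w. w \<in> polydisc \<Longrightarrow> (\<And>i. norm (w $ i) < r) \<Longrightarrow> f w = 0"
    and w: "w \<in> polydisc"
  shows "f w = 0"
proof -
  define M where "M = Max (range (\<lambda>i. norm (w $ i)))"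
  have M: "norm (w $ i) \<le> M" for i unfolding M_def by (rule Max_ge) auto
  have "M \<in> range (\<lambda>i. norm (w $ i))" unfolding M_def by (rule Max_in) auto
  hence M1: "0 \<le> M" "M < 1" using w by (auto simp: polydisc_def)
  \<comment> \<open>any radius strictly between \<open>1\<close> and \<open>1 / M\<close> would do; this choice also covers \<open>M = 0\<close>\<close>
  define R where "R = 2 / (1 + M)"
  have R: "1 < R" "R * M < 1" "0 < R" using M1 by (auto simp: R_def field_simps)
  have in_disc: "t *s w \<in> polydisc" if "t \<in> ball 0 R" for t
  proof -
    have "norm (t * w $ i) < 1" for i
    proof -
      have "norm (t * w $ i) \<le> R * M"
        using that M[of i] R M1 by (auto simp: norm_mult intro!: mult_mono)
      thus ?thesis using R by simp
    qed
    thus ?thesis by (simp add: polydisc_def)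
  qed
  have "f (1 *s w) $ j = 0" for j
  proof (rule analytic_continuation_open[where s = "ball 0 (min r R)" and s' = "ball 0 R"
        and f = "\<lambda>t. f (t *s w) $ j" and g = "\<lambda>_. 0"])
    show "(\<lambda>t. f (t *s w) $ j) holomorphic_on ball 0 R"
      by (rule sv_holomorphic_on_line[OF f in_disc])
    fix t :: complex assume t: "t \<in> ball 0 (min r R)"
    have "norm ((t *s w) $ i) < r" for i
    proof -
      have "norm ((t *s w) $ i) \<le> norm t * 1"
        using w by (auto simp: norm_mult polydisc_def less_imp_le intro!: mult_left_le)
      thus ?thesis using t by simp
    qed
    thus "f (t *s w) $ j = 0" using zero in_disc[of t] t by simp
  qed (use r R in auto)
  thus ?thesis by (simp add: vec_eq_iff)
qed

lemma coordinate_permutation_in_aut_polydisc: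
  fixes i j :: "'n::finite"
  shows "(\<lambda>z. \<chi> k. z $ Transposition.transpose i j k) \<in> (aut_polydisc :: (complex^'n \<Rightarrow> complex^'n) set)"
proof -
  let ?g = "\<lambda>z :: complex^'n. \<chi> k. z $ Transposition.transpose i j k"
  have gg: "?g (?g z) = z" for z by (simp add: vec_eq_iff)
  have g: "?g z \<in> polydisc \<longleftrightarrow> z \<in> polydisc" for z
    unfolding polydisc_def by (simp, metis transpose_involutory)
  have bij: "bij_betw ?g polydisc polydisc"
    by (rule bij_betwI[where g = ?g]) (simp_all only: Pi_iff g gg, simp_all)
  have "linear ?g" by (rule linearI) (auto simp: vec_eq_iff)
  hence D: "(?g has_derivative ?g) (at z)" for z
    by (intro bounded_linear_imp_has_derivative) (simp add: linear_conv_bounded_linear)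
  have hol: "?g sv_holomorphic_on polydisc"
    unfolding sv_holomorphic_on_def using D by (force simp: vec_eq_iff)
  have inv: "inv_into polydisc ?g z = ?g z" if "z \<in> polydisc" for z
    by (rule inv_into_f_eq) (use bij g gg that in \<open>auto simp: bij_betw_def\<close>)
  have "(inv_into polydisc ?g has_derivative ?g) (at z)" if "z \<in> polydisc" for z
    by (rule has_derivative_transform_within_open[OF D open_polydisc that]) (simp add: inv)
  hence "inv_into polydisc ?g sv_holomorphic_on polydisc"
    unfolding sv_holomorphic_on_def by (force simp: vec_eq_iff)
  thus ?thesis using bij hol by (simp add: aut_polydisc_def)
qed

section \<open>Coordinate multiplication on a reproducing kernel space\<close>

lemma coordinate_mult_apply: "coordinate_mult i f z = z $ i *s f z"
  by (simp add: coordinate_mult_def)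

lemma coordinate_mult_power: "(coordinate_mult i ^^ n) f = (\<lambda>z. (z $ i) ^ n *s f z)"
  by (induction n) (auto simp: fun_eq_iff vec_eq_iff mult_ac coordinate_mult_apply)

text \<open>A reproducing kernel space on which the coordinate multiplications are bounded operators,
  with one common bound \<open>C\<close>. Taking \<open>C\<close> at least \<open>1\<close> makes \<open>\<bar>b\<bar> C < 1\<close> sufficient both for
  convergence of power series in \<open>b T\<^sub>i\<close> and for \<open>b\<close> to lie in the disc.\<close>
locale polydisc_module = complex_hilbert_space fscale H ip
  for H :: "(complex^'n::{finite,linorder} \<Rightarrow> complex^'m) set" and ip +
  fixes K :: "complex^'n::{finite,linorder} \<Rightarrow> complex^'n::{finite,linorder} \<Rightarrow> complex^'m^'m" and C :: real
  assumes rk: "reproducing_kernel_space K H ip"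
    and C_ge: "1 \<le> C"
    and mult_in_H: "f \<in> H \<Longrightarrow> coordinate_mult i f \<in> H"
    and mult_bound: "f \<in> H \<Longrightarrow> hnorm (coordinate_mult i f) \<le> C * hnorm f"
begin

definition kern :: "complex^'n::{finite,linorder} \<Rightarrow> complex^'m \<Rightarrow> complex^'n::{finite,linorder} \<Rightarrow> complex^'m" where
  "kern w \<xi> = (\<lambda>z. if z \<in> polydisc then K z w *v \<xi> else 0)"

lemma kern_in_H: "w \<in> polydisc \<Longrightarrow> kern w \<xi> \<in> H"
  and reproducing: "w \<in> polydisc \<Longrightarrow> f \<in> H \<Longrightarrow> ip f (kern w \<xi>) = (\<Sum>j\<in>UNIV. f w $ j * cnj (\<xi> $ j))"
  using rk unfolding reproducing_kernel_space_def kern_def Let_def by blast+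

lemma reproducing_axis: "w \<in> polydisc \<Longrightarrow> f \<in> H \<Longrightarrow> ip f (kern w (axis j 1)) = f w $ j"
proof -
  assume "w \<in> polydisc" "f \<in> H"
  moreover have "(\<Sum>k\<in>UNIV. f w $ k * cnj (axis j 1 $ k)) = f w $ j"
    by (subst sum.mono_neutral_right[of _ "{j}"]) (auto simp: axis_def)
  ultimately show ?thesis by (simp add: reproducing)
qed

lemma holomorphic: "f \<in> H \<Longrightarrow> f sv_holomorphic_on polydisc"
  and zero_outside: "f \<in> H \<Longrightarrow> z \<notin> polydisc \<Longrightarrow> f z = 0"
  using rk unfolding reproducing_kernel_space_def by blast+

lemma mult_power_in_H: "f \<in> H \<Longrightarrow> (coordinate_mult i ^^ n) f \<in> H"
  by (induction n) (auto simp: mult_in_H)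

lemma small_norm: "norm b * C < 1 \<Longrightarrow> norm b < 1"
  using mult_left_mono[of 1 C "norm b"] C_ge by simp

text \<open>Multiplication by \<open>\<phi>(b z\<^sub>i)\<close> is the operator \<open>\<phi>(b T\<^sub>i)\<close>: the abstract series has the right
  point evaluations because these are inner products with kernel functions.\<close>
lemma series_mult:
  assumes f: "f \<in> H" and \<phi>: "\<And>t. norm t < 1 \<Longrightarrow> (\<lambda>n. c n * t ^ n) sums \<phi> t"
    and b: "norm b * C < 1"
  shows "(\<lambda>z. \<phi> (b * z $ i) *s f z) \<in> H" (is "?g \<in> H")
    and "h \<in> H \<Longrightarrow> (\<lambda>n. c n * ip ((coordinate_mult i ^^ n) f) h * b ^ n) sums
      ip (\<lambda>z. \<phi> (b * z $ i) *s f z) h"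
proof -
  have "\<exists>s\<in>H. \<forall>h\<in>H. (\<lambda>n. c n * ip ((coordinate_mult i ^^ n) f) h * b ^ n) sums ip s h"
    by (rule operator_power_series[where C = C])
       (use mult_in_H mult_bound C_ge \<phi>[THEN sums_summable] b f in auto)
  then obtain s where s: "s \<in> H"
    and sums: "\<And>h. h \<in> H \<Longrightarrow> (\<lambda>n. c n * ip ((coordinate_mult i ^^ n) f) h * b ^ n) sums ip s h"
    by blast
  have Tn: "(coordinate_mult i ^^ n) f \<in> H" for n
    using f by (rule mult_power_in_H)
  have "s z = ?g z" for z
  proof (cases "z \<in> polydisc")
    case z: True
    have "norm (b * z $ i) \<le> norm b * 1"
      unfolding norm_mult using z by (intro mult_left_mono) (auto simp: polydisc_def less_imp_le)
    hence small: "norm (b * z $ i) < 1" using small_norm[OF b] by simp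
    have "s z $ j = \<phi> (b * z $ i) * f z $ j" for j
    proof -
      have "(\<lambda>n. c n * ((z $ i) ^ n * f z $ j) * b ^ n) sums (s z $ j)"
        using sums[OF kern_in_H[OF z], of "axis j 1"] z s Tn
        by (simp add: reproducing_axis) (simp add: coordinate_mult_power)
      moreover have "(\<lambda>n. c n * (b * z $ i) ^ n * f z $ j) sums (\<phi> (b * z $ i) * f z $ j)"
        by (intro sums_mult2 \<phi> small)
      ultimately show ?thesis
        by (simp add: power_mult_distrib mult_ac sums_unique2)
    qed
    thus ?thesis by (simp add: vec_eq_iff)
  qed (use s f in \<open>simp add: zero_outside\<close>)
  hence "s = ?g" by blast
  thus "?g \<in> H" and "h \<in> H \<Longrightarrow> (\<lambda>n. c n * ip ((coordinate_mult i ^^ n) f) h * b ^ n) sums ip ?g h"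
    using s sums by auto
qed

text \<open>The joint kernel of the adjoints of the coordinate multiplications. It is described as the
  orthogonal complement of their ranges, which avoids constructing adjoints.\<close>
definition adjoint_kernel :: "(complex^'n::{finite,linorder} \<Rightarrow> complex^'m) set" where
  "adjoint_kernel = {x \<in> H. \<forall>i. \<forall>f\<in>H. ip (coordinate_mult i f) x = 0}"

lemma kern_0_in_adjoint_kernel: "kern 0 \<xi> \<in> adjoint_kernel"
  unfolding adjoint_kernel_def using kern_in_H[OF zero_in_polydisc]
  by (auto simp: reproducing zero_in_polydisc mult_in_H coordinate_mult_apply)

text \<open>All terms of the series except the constant one lie in the range of \<open>T\<^sub>i\<close>, to which
  \<open>x\<close> is orthogonal.\<close>
lemma series_mult_adjoint_kernel:
  assumes "f \<in> H" and \<phi>: "\<And>t. norm t < 1 \<Longrightarrow> (\<lambda>n. c n * t ^ n) sums \<phi> t" and "c 0 = 1"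
    and "norm b * C < 1" and x: "x \<in> adjoint_kernel"
  shows "ip (\<lambda>z. \<phi> (b * z $ i) *s f z) x = ip f x"
proof -
  have Tn: "(coordinate_mult i ^^ n) f \<in> H" for n
    using assms(1) by (rule mult_power_in_H)
  have x': "x \<in> H" using x by (simp add: adjoint_kernel_def)
  have "c n * ip ((coordinate_mult i ^^ n) f) x * b ^ n = (if n = 0 then ip f x else 0)" for n
    using x Tn \<open>c 0 = 1\<close> by (cases n) (auto simp: adjoint_kernel_def)
  thus ?thesis
    using series_mult(2)[where i = i, OF assms(1) \<phi> assms(4) x']
      sums_single[of 0 "\<lambda>n. ip f x"] by (simp add: sums_unique2)
qed

text \<open>Kernel functions of a tensor product are products of power series in the single variables;
  as its constant term is \<open>1\<close>, each factor leaves the inner products with the joint kernel unchanged.\<close>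
lemma prod_series_mult:
  assumes "finite A" and "f \<in> H"
    and \<phi>: "\<And>i t. norm t < 1 \<Longrightarrow> (\<lambda>n. c i n * t ^ n) sums \<phi> i t" and c: "\<And>i. c i 0 = 1"
    and b: "\<And>i. norm (b i) * C < 1"
  shows "(\<lambda>z. (\<Prod>i\<in>A. \<phi> i (b i * z $ i)) *s f z) \<in> H \<and>
    (\<forall>x\<in>adjoint_kernel. ip (\<lambda>z. (\<Prod>i\<in>A. \<phi> i (b i * z $ i)) *s f z) x = ip f x)"
  using assms(1)
proof induction
  case empty
  thus ?case using \<open>f \<in> H\<close> by simp
next
  case (insert k A)
  let ?g = "\<lambda>z. (\<Prod>i\<in>A. \<phi> i (b i * z $ i)) *s f z"
  have eq: "(\<lambda>z. (\<Prod>i\<in>insert k A. \<phi> i (b i * z $ i)) *s f z) = (\<lambda>z. \<phi> k (b k * z $ k) *s ?g z)"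
    using insert by (simp add: vector_smult_assoc)
  have g: "?g \<in> H" using insert by blast
  show ?case unfolding eq
    using series_mult(1)[where \<phi> = "\<phi> k" and i = k, OF g \<phi> b]
      series_mult_adjoint_kernel[where \<phi> = "\<phi> k" and i = k, OF g \<phi> c b] insert by simp
qed

lemma eq_if_eq_near_0:
  assumes "f \<in> H" "g \<in> H" "0 < r"
    and eq: "\<And>w. w \<in> polydisc \<Longrightarrow> (\<And>i. norm (w $ i) < r) \<Longrightarrow> f w = g w"
  shows "f = g"
proof
  fix w
  have d: "f - g \<in> H" using assms by (simp add: diff_in_H)
  show "f w = g w"
  proof (cases "w \<in> polydisc")
    case True
    have "(f - g) w = 0"
      by (rule sv_holomorphic_eq_0[OF holomorphic[OF d] \<open>0 < r\<close> _ True]) (simp add: eq)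
    thus ?thesis by simp
  qed (use assms in \<open>simp add: zero_outside\<close>)
qed

lemma op_monomial_coordinate_mult:
  "op_monomial coordinate_mult \<alpha> f z = (\<Prod>i\<in>UNIV. (z $ i) ^ \<alpha> i) *s f z"
proof -
  have "foldr (\<lambda>i. (\<circ>) (coordinate_mult i ^^ \<alpha> i)) xs id f z = (\<Prod>i\<in>set xs. (z $ i) ^ \<alpha> i) *s f z"
    if "distinct xs" for xs
    using that by (induction xs) (auto simp: coordinate_mult_power vector_smult_assoc vec_eq_iff mult_ac)
  from this[of "sorted_list_of_set UNIV"] show ?thesis
    by (simp add: op_monomial_def)
qed

text \<open>The operator series defining \<open>f(T)\<close> is evaluated at a point, where it becomes the
  power series of \<open>f\<close> times the vector \<open>x z\<close>; point evaluation is continuous by Cauchy-Schwarz.\<close>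
lemma functional_calculus_coordinate_mult:
  assumes S: "functional_calculus f coordinate_mult S" and x: "x \<in> H" and z: "z \<in> polydisc"
  shows "S x z = f z *s x z"
proof -
  let ?T = "coordinate_mult :: 'n \<Rightarrow> (complex^'n::{finite,linorder} \<Rightarrow> complex^'m) \<Rightarrow> _"
  obtain a :: "('n \<Rightarrow> nat) \<Rightarrow> complex" where
    a: "((\<lambda>\<alpha>. a \<alpha> * (\<Prod>i\<in>UNIV. (z $ i) ^ \<alpha> i)) has_sum f z) UNIV"
    and lim: "\<And>e. 0 < e \<Longrightarrow> \<exists>F. finite F \<and> (\<forall>G. finite G \<and> F \<subseteq> G \<longrightarrow> (\<forall>x\<in>H.
           hnorm ((\<Sum>\<alpha>\<in>G. fscale (a \<alpha>) (op_monomial ?T \<alpha> x)) - S x) \<le> e * hnorm x))"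
    and SH: "S x \<in> H"
  proof -
    obtain a :: "('n \<Rightarrow> nat) \<Rightarrow> complex" where
      "\<forall>z\<in>polydisc. ((\<lambda>\<alpha>. a \<alpha> * (\<Prod>i\<in>UNIV. (z $ i) ^ \<alpha> i)) has_sum f z) UNIV"
      "\<forall>e>0. \<exists>F. finite F \<and> (\<forall>G. finite G \<and> F \<subseteq> G \<longrightarrow> (\<forall>x\<in>H.
           hnorm ((\<Sum>\<alpha>\<in>G. fscale (a \<alpha>) (op_monomial ?T \<alpha> x)) - S x) \<le> e * hnorm x))"
      "\<forall>x\<in>H. S x \<in> H"
      using S unfolding functional_calculus_def by (elim conjE exE) (rule that)
    thus thesis using that[of a] x z by simp
  qed
  have opH: "op_monomial ?T \<alpha> x \<in> H" for \<alpha>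
  proof -
    have "foldr (\<lambda>i. (\<circ>) (?T i ^^ \<alpha> i)) xs id x \<in> H" for xs
    proof (induction xs)
      case (Cons i xs)
      thus ?case using mult_power_in_H by simp
    qed (simp add: x)
    thus ?thesis by (simp add: op_monomial_def)
  qed
  have "S x z $ j = f z * x z $ j" for j
  proof -
    define k where "k = kern z (axis j 1)"
    have k: "k \<in> H" using kern_in_H[OF z] by (simp add: k_def)
    let ?P = "\<lambda>G. \<Sum>\<alpha>\<in>G. fscale (a \<alpha>) (op_monomial ?T \<alpha> x)"
    have PH: "?P G \<in> H" for G by (intro sum_in_H scale_in_H opH)
    have P: "?P G z $ j = (\<Sum>\<alpha>\<in>G. a \<alpha> * (\<Prod>i\<in>UNIV. (z $ i) ^ \<alpha> i)) * x z $ j" for G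
      by (induction G rule: infinite_finite_induct)
         (auto simp: fscale_def op_monomial_coordinate_mult algebra_simps)
    have "((\<lambda>G. ?P G z $ j) \<longlongrightarrow> S x z $ j) (finite_subsets_at_top UNIV)"
    proof (rule tendstoI)
      fix e :: real assume e: "0 < e"
      define M where "M = hnorm x * hnorm k + 1"
      have M: "0 < M" using x k by (simp add: M_def add_nonneg_pos)
      obtain F where F: "finite F" and FG: "\<And>G. finite G \<Longrightarrow> F \<subseteq> G \<Longrightarrow>
          hnorm (?P G - S x) \<le> e / M * hnorm x"
        using lim[of "e / M"] e M x by (auto simp del: times_divide_eq_left)
      show "eventually (\<lambda>G. dist (?P G z $ j) (S x z $ j) < e) (finite_subsets_at_top UNIV)"
        unfolding eventually_finite_subsets_at_top
      proof (intro exI[of _ F] conjI allI impI F)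
        fix G assume G: "finite G \<and> F \<subseteq> G \<and> G \<subseteq> UNIV"
        have "dist (?P G z $ j) (S x z $ j) = norm (ip (?P G - S x) k)"
          using PH SH k z by (simp add: dist_norm ip_diff_left k_def reproducing_axis)
        also have "\<dots> \<le> hnorm (?P G - S x) * hnorm k"
          by (intro Cauchy_Schwarz diff_in_H PH SH k)
        also have "\<dots> \<le> e / M * hnorm x * hnorm k"
          using FG[of G] G k by (intro mult_right_mono) auto
        also have "\<dots> < e" using e M by (simp add: M_def field_simps)
        finally show "dist (?P G z $ j) (S x z $ j) < e" .
      qed auto
    qed
    moreover have "((\<lambda>G. ?P G z $ j) \<longlongrightarrow> f z * x z $ j) (finite_subsets_at_top UNIV)"
      unfolding P using a unfolding has_sum_def by (intro tendsto_mult_right)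
    ultimately show ?thesis
      using tendsto_unique finite_subsets_at_top_neq_bot by blast
  qed
  thus ?thesis by (simp add: vec_eq_iff)
qed

end

section \<open>The tensor product space\<close>

text \<open>The first variable \<open>i1\<close> carries the \<open>\<complex>\<^sup>2\<close>-valued factor.\<close>
locale polydisc_tensor_module =
  polydisc_module H ip "tensor_kernel lam \<mu>" C
  for H :: "(complex^'n::{finite,linorder} \<Rightarrow> complex^2) set" and ip and lam :: "'n \<Rightarrow> real" and \<mu> C +
  assumes lam_pos: "0 < lam i" and mu_pos: "0 < \<mu>"
begin

abbreviation "i1 \<equiv> Min (UNIV :: 'n set)"

text \<open>The lower right entry of the kernel at the origin, where the kernel is diagonal with entries
  \<open>1\<close> and \<open>kappa\<close>.\<close>
definition kappa :: real where "kappa = 1 / lam i1 + \<mu>"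

abbreviation T :: "'n \<Rightarrow> (complex^'n::{finite,linorder} \<Rightarrow> complex^2) \<Rightarrow> complex^'n::{finite,linorder} \<Rightarrow> complex^2"
  where "T \<equiv> coordinate_mult"

definition basis_fun :: "2 \<Rightarrow> complex^'n::{finite,linorder} \<Rightarrow> complex^2" where
  "basis_fun p = (\<lambda>z. if z \<in> polydisc then axis p 1 else 0)"

lemma kappa_pos: "0 < kappa" and lam_kappa: "1 < lam i1 * kappa"
  using lam_pos[of i1] mu_pos by (auto simp: kappa_def field_simps add_pos_pos)

lemma tensor_kernel_entries:
  "tensor_kernel lam \<mu> z w $ 1 $ 1 = (\<Prod>i\<in>UNIV - {i1}. szego_power (lam i) (cnj (w $ i) * z $ i)) *
     szego_power (lam i1) (cnj (w $ i1) * z $ i1)"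
  "tensor_kernel lam \<mu> z w $ 1 $ 2 = (\<Prod>i\<in>UNIV - {i1}. szego_power (lam i) (cnj (w $ i) * z $ i)) *
     (z $ i1 * szego_power (lam i1 + 1) (cnj (w $ i1) * z $ i1))"
  "tensor_kernel lam \<mu> z w $ 2 $ 1 = (\<Prod>i\<in>UNIV - {i1}. szego_power (lam i) (cnj (w $ i) * z $ i)) *
     (cnj (w $ i1) * szego_power (lam i1 + 1) (cnj (w $ i1) * z $ i1))"
  "tensor_kernel lam \<mu> z w $ 2 $ 2 = (\<Prod>i\<in>UNIV - {i1}. szego_power (lam i) (cnj (w $ i) * z $ i)) *
     ((of_real kappa + cnj (w $ i1) * z $ i1) * szego_power (lam i1 + 2) (cnj (w $ i1) * z $ i1))"
  by (simp_all add: tensor_kernel_def disc_kernel_def disc_kernel2_def szego_power_def kappa_def Let_def vector_2 mult_ac)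

lemma kern_0: "kern 0 \<xi> = T i1 (fscale (\<xi> $ 2) (basis_fun 1)) + (fscale (\<xi> $ 1) (basis_fun 1) + fscale (of_real kappa * \<xi> $ 2) (basis_fun 2))"
  by (auto simp: fun_eq_iff kern_def vec_eq_iff forall_2 matrix_vector_mult_def sum_2 UNIV_2
      tensor_kernel_entries coordinate_mult_apply basis_fun_def fscale_def axis_def mult_ac)

lemma basis_fun_1_eq: "basis_fun 1 = kern 0 (axis 1 1)"
  by (auto simp: kern_0 fun_eq_iff coordinate_mult_apply fscale_def axis_def vec_eq_iff)

lemma basis_fun_1_in_H: "basis_fun 1 \<in> H"
  unfolding basis_fun_1_eq by (rule kern_in_H[OF zero_in_polydisc])

lemma kern_0_axis2: "kern 0 (axis 2 1) = T i1 (basis_fun 1) + fscale (of_real kappa) (basis_fun 2)"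
  by (auto simp: kern_0 fun_eq_iff coordinate_mult_apply fscale_def axis_def vec_eq_iff)

text \<open>The two kernel functions at \<open>0\<close> are \<open>(1, 0)\<close> and \<open>(z\<^sub>1, kappa)\<close>. Since \<open>(z\<^sub>1, 0)\<close> is in the
  space by boundedness of \<open>T\<^sub>1\<close>, so is \<open>(0, 1)\<close>.\<close>
lemma basis_fun_2_in_H: "basis_fun 2 \<in> H"
proof -
  have "basis_fun 2 = fscale (1 / of_real kappa) (kern 0 (axis 2 1) - T i1 (basis_fun 1))"
    using kappa_pos by (auto simp: kern_0_axis2 fun_eq_iff fscale_def vec_eq_iff)
  moreover have "fscale (1 / of_real kappa) (kern 0 (axis 2 1) - T i1 (basis_fun 1)) \<in> H"
    by (intro scale_in_H diff_in_H kern_in_H zero_in_polydisc mult_in_H basis_fun_1_in_H)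
  ultimately show ?thesis by simp
qed

lemma T_basis_fun_in_H: "T i1 (basis_fun 1) \<in> H" "T i1 (basis_fun 2) \<in> H"
  by (intro mult_in_H basis_fun_1_in_H basis_fun_2_in_H)+

text \<open>The parts of \<open>K(\<cdot>,w)e\<^sub>1\<close> and \<open>K(\<cdot>,w)e\<^sub>2\<close> that come from the first tensor factor, as functions
  of \<open>b\<close>, the conjugate of \<open>w\<^sub>1\<close>. They are written as operator power series in \<open>b T\<^sub>1\<close> applied to
  constant functions and their images under \<open>T\<^sub>1\<close>.\<close>
definition kern_factor1 :: "complex \<Rightarrow> complex^'n::{finite,linorder} \<Rightarrow> complex^2" where
  "kern_factor1 b = (\<lambda>z. szego_power (lam i1) (b * z $ i1) *s basis_fun 1 z) +
     fscale b (\<lambda>z. szego_power (lam i1 + 1) (b * z $ i1) *s basis_fun 2 z)"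

definition kern_factor2 :: "complex \<Rightarrow> complex^'n::{finite,linorder} \<Rightarrow> complex^2" where
  "kern_factor2 b = (\<lambda>z. szego_power (lam i1 + 1) (b * z $ i1) *s T i1 (basis_fun 1) z) +
     (fscale (of_real kappa) (\<lambda>z. szego_power (lam i1 + 2) (b * z $ i1) *s basis_fun 2 z) +
      fscale b (\<lambda>z. szego_power (lam i1 + 2) (b * z $ i1) *s T i1 (basis_fun 2) z))"

lemma kern_axis:
  "kern w (axis 1 1) = (\<lambda>z. (\<Prod>i\<in>UNIV - {i1}. szego_power (lam i) (cnj (w $ i) * z $ i)) *s kern_factor1 (cnj (w $ i1)) z)"
  "kern w (axis 2 1) = (\<lambda>z. (\<Prod>i\<in>UNIV - {i1}. szego_power (lam i) (cnj (w $ i) * z $ i)) *s kern_factor2 (cnj (w $ i1)) z)"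
  by (auto simp: fun_eq_iff kern_def vec_eq_iff forall_2 matrix_vector_mult_def sum_2 UNIV_2
      tensor_kernel_entries coordinate_mult_apply basis_fun_def fscale_def axis_def kern_factor1_def kern_factor2_def algebra_simps)

lemma szego_power_mult_in_H:
  assumes "norm b * C < 1" "f \<in> H"
  shows "(\<lambda>z. szego_power l (b * z $ i) *s f z) \<in> H"
  using series_mult(1)[OF assms(2) szego_power_sums assms(1)] .

lemma kern_factor_in_H:
  assumes b: "norm b * C < 1"
  shows "kern_factor1 b \<in> H" and "kern_factor2 b \<in> H"
  unfolding kern_factor1_def kern_factor2_def
  by (intro add_in_H scale_in_H szego_power_mult_in_H b basis_fun_1_in_H basis_fun_2_in_H T_basis_fun_in_H)+

lemma ip_kern_factor_adjoint_kernel: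
  assumes b: "norm b * C < 1" and x: "x \<in> adjoint_kernel"
  shows "ip (kern_factor1 b) x = ip (basis_fun 1) x + b * ip (basis_fun 2) x" and "ip (kern_factor2 b) x = of_real kappa * ip (basis_fun 2) x"
proof -
  have xH: "x \<in> H" and Tx: "ip (T i1 (basis_fun p)) x = 0" for p
    using x basis_fun_1_in_H basis_fun_2_in_H exhaust_2[of p] by (auto simp: adjoint_kernel_def)
  have *: "ip (\<lambda>z. szego_power l (b * z $ i1) *s f z) x = ip f x" if "f \<in> H" for l f
    using series_mult_adjoint_kernel[OF that szego_power_sums _ b x] by simp
  show "ip (kern_factor1 b) x = ip (basis_fun 1) x + b * ip (basis_fun 2) x" "ip (kern_factor2 b) x = of_real kappa * ip (basis_fun 2) x"
    unfolding kern_factor1_def kern_factor2_def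
    by (simp_all add: ip_add ip_scale add_in_H scale_in_H szego_power_mult_in_H b basis_fun_1_in_H basis_fun_2_in_H T_basis_fun_in_H xH * Tx)
qed

text \<open>Against an element \<open>x\<close> of the joint kernel, each power series multiplier with
  constant term \<open>1\<close> acts as the identity.
  Hence \<open>x w\<close>, which is given by inner products with \<open>K(\<cdot>,w)e\<^sub>1\<close> and \<open>K(\<cdot>,w)e\<^sub>2\<close>, is
  an explicit polynomial in \<open>w\<^sub>1\<close> for small \<open>w\<close>, and the identity theorem extends
  this to the whole polydisc.\<close>
lemma adjoint_kernel_eq_kern_0:
  assumes x: "x \<in> adjoint_kernel"
  shows "\<exists>\<xi>. x = kern 0 \<xi>"
proof -
  have xH: "x \<in> H" using x by (simp add: adjoint_kernel_def)
  define \<xi> :: "complex^2" where "\<xi> = (\<chi> p. if p = 1 then ip x (basis_fun 1) else ip x (basis_fun 2))"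
  have "x = kern 0 \<xi>"
  proof (rule eq_if_eq_near_0[OF xH kern_in_H[OF zero_in_polydisc], of "1 / C"])
    show "0 < 1 / C" using C_ge by simp
    fix w :: "complex^'n::{finite,linorder}" assume w: "w \<in> polydisc" and "\<And>i. norm (w $ i) < 1 / C"
    hence small: "norm (cnj (w $ i)) * C < 1" for i
      using C_ge by (simp add: field_simps)
    have ip_kern: "ip (\<lambda>z. (\<Prod>i\<in>UNIV - {i1}. szego_power (lam i) (cnj (w $ i) * z $ i)) *s f z) x = ip f x"
      if "f \<in> H" for f
      using prod_series_mult[where A = "UNIV - {i1}" and \<phi> = "\<lambda>i. szego_power (lam i)" and b = "\<lambda>i. cnj (w $ i)",
          OF _ that szego_power_sums _ small] x by simp
    have "x w $ 1 = cnj (ip (kern w (axis 1 1)) x)" "x w $ 2 = cnj (ip (kern w (axis 2 1)) x)"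
      using w xH by (simp_all add: reproducing_axis kern_in_H flip: ip_cnj)
    hence "x w $ 1 = ip x (basis_fun 1) + w $ i1 * ip x (basis_fun 2)" "x w $ 2 = of_real kappa * ip x (basis_fun 2)"
      unfolding kern_axis using xH basis_fun_1_in_H basis_fun_2_in_H
      by (simp_all add: ip_kern kern_factor_in_H[OF small] ip_kern_factor_adjoint_kernel[OF small x] flip: ip_cnj)
    thus "x w = kern 0 \<xi> w"
      using w by (simp add: kern_0 vec_eq_iff forall_2 coordinate_mult_apply fscale_def basis_fun_def axis_def \<xi>_def)
  qed
  thus ?thesis by blast
qed

lemma ip_szego_power_expansion:
  assumes f: "f \<in> H" and h: "h \<in> H"
  shows "(\<lambda>b. ip (\<lambda>z. szego_power l (b * z $ i) *s f z) h) has_fps_expansion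
    Abs_fps (\<lambda>n. szego_coeff l n * ip ((T i ^^ n) f) h)"
proof (rule sums_imp_has_fps_expansion)
  show "0 < 1 / C" using C_ge by simp
  fix b :: complex assume "norm b < 1 / C"
  hence "norm b * C < 1" using C_ge by (simp add: field_simps)
  from series_mult(2)[OF f szego_power_sums this h]
  show "(\<lambda>n. szego_coeff l n * ip ((T i ^^ n) f) h * b ^ n) sums ip (\<lambda>z. szego_power l (b * z $ i) *s f z) h" .
qed

lemma eventually_small: "eventually (\<lambda>b :: complex. norm b * C < 1) (nhds 0)"
proof -
  have "eventually (\<lambda>b :: complex. b \<in> ball 0 (1 / C)) (nhds 0)"
    using C_ge by (intro eventually_nhds_in_open) auto
  thus ?thesis by eventually_elim (use C_ge in \<open>simp add: field_simps\<close>)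
qed

text \<open>Along the \<open>j\<close>-th axis \<open>K(\<cdot>,w)\<xi>\<close> is \<open>K(\<cdot>,0)\<xi>\<close> times a scalar power series with linear
  coefficient \<open>lam j\<close>. Its inner product with \<open>T\<^sub>j K(\<cdot>,0)\<xi>\<close> is known from the reproducing
  property, and the linear terms give the claim.\<close>
lemma norm_mult_kern_0_other_variable:
  assumes j: "j \<noteq> i1"
  shows "of_real (lam j) * ip (T j (kern 0 \<xi>)) (T j (kern 0 \<xi>)) = ip (kern 0 \<xi>) (kern 0 \<xi>)"
proof -
  let ?x = "kern 0 \<xi>"
  have x: "?x \<in> H" by (rule kern_in_H[OF zero_in_polydisc])
  have Tx: "T j ?x \<in> H" by (rule mult_in_H[OF x])
  have "eventually (\<lambda>b. ip (\<lambda>z. szego_power (lam j) (b * z $ j) *s ?x z) (T j ?x) = b * ip ?x ?x) (nhds 0)"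
    using eventually_small
  proof eventually_elim
    fix b :: complex assume b: "norm b * C < 1"
    define w :: "complex^'n::{finite,linorder}" where "w = axis j (cnj b)"
    have w: "w \<in> polydisc" using small_norm[OF b] by (simp add: w_def axis_in_polydisc)
    have w1: "w $ i1 = 0" and wj: "w $ j = cnj b" using j by (auto simp: w_def axis_def)
    have P: "(\<Prod>i\<in>UNIV - {i1}. szego_power (lam i) (cnj (w $ i) * z $ i)) = szego_power (lam j) (b * z $ j)" for z :: "complex^'n::{finite,linorder}"
      by (subst prod.mono_neutral_right[of _ "{j}"]) (use j in \<open>auto simp: w_def axis_def\<close>)
    have "tensor_kernel lam \<mu> z w = (\<chi> p. szego_power (lam j) (b * z $ j) *s (tensor_kernel lam \<mu> z 0 $ p))" for z
      by (simp add: vec_eq_iff forall_2 tensor_kernel_entries w1 P)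
    hence "(\<lambda>z. szego_power (lam j) (b * z $ j) *s ?x z) = kern w \<xi>"
      by (auto simp: kern_def fun_eq_iff vec_eq_iff matrix_vector_mult_def sum_distrib_left mult_ac)
    hence "ip (\<lambda>z. szego_power (lam j) (b * z $ j) *s ?x z) (T j ?x) = cnj (ip (T j ?x) (kern w \<xi>))"
      using ip_cnj[OF Tx kern_in_H[OF w]] by simp
    also have "\<dots> = b * cnj (\<Sum>p\<in>UNIV. ?x w $ p * cnj (\<xi> $ p))"
      by (simp add: reproducing[OF w Tx] coordinate_mult_apply wj sum_distrib_left mult_ac)
    also have "?x w = ?x 0"
      by (simp add: kern_def w zero_in_polydisc vec_eq_iff forall_2 matrix_vector_mult_def sum_2 tensor_kernel_entries w1)
    also have "(\<Sum>p\<in>UNIV. ?x 0 $ p * cnj (\<xi> $ p)) = ip ?x ?x"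
      by (simp add: reproducing[OF zero_in_polydisc x])
    also have "cnj (ip ?x ?x) = ip ?x ?x" by (simp add: ip_self[OF x])
    finally show "ip (\<lambda>z. szego_power (lam j) (b * z $ j) *s ?x z) (T j ?x) = b * ip ?x ?x" .
  qed
  moreover have "(\<lambda>b. b * ip ?x ?x) has_fps_expansion fps_X * fps_const (ip ?x ?x)"
    by (intro fps_expansion_intros)
  ultimately have "(\<lambda>b. ip (\<lambda>z. szego_power (lam j) (b * z $ j) *s ?x z) (T j ?x)) has_fps_expansion
      fps_X * fps_const (ip ?x ?x)"
    by (rule has_fps_expansion_transform)
  from has_fps_expansion_unique[OF this ip_szego_power_expansion[OF x Tx]]
  have "fps_nth (fps_X * fps_const (ip ?x ?x)) 1 =
    fps_nth (Abs_fps (\<lambda>n. szego_coeff (lam j) n * ip ((T j ^^ n) ?x) (T j ?x))) 1" by simp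
  thus ?thesis by simp
qed

text \<open>Along the first axis the components of \<open>f\<close> are inner products with \<open>kern_factor1\<close> and
  \<open>kern_factor2\<close>. For an \<open>f\<close> with known components, comparing coefficients yields linear equations
  for inner products with \<open>f\<close>.\<close>
lemma component_expansions:
  assumes f: "f \<in> H"
  shows "(\<lambda>b. cnj (f (axis i1 (cnj b)) $ 1)) has_fps_expansion
      Abs_fps (\<lambda>n. szego_coeff (lam i1) n * ip ((T i1 ^^ n) (basis_fun 1)) f) +
      fps_X * Abs_fps (\<lambda>n. szego_coeff (lam i1 + 1) n * ip ((T i1 ^^ n) (basis_fun 2)) f)" (is "?f1 has_fps_expansion ?F1")
    and "(\<lambda>b. cnj (f (axis i1 (cnj b)) $ 2)) has_fps_expansion
      Abs_fps (\<lambda>n. szego_coeff (lam i1 + 1) n * ip ((T i1 ^^ n) (T i1 (basis_fun 1))) f) +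
      (fps_const (of_real kappa) * Abs_fps (\<lambda>n. szego_coeff (lam i1 + 2) n * ip ((T i1 ^^ n) (basis_fun 2)) f) +
       fps_X * Abs_fps (\<lambda>n. szego_coeff (lam i1 + 2) n * ip ((T i1 ^^ n) (T i1 (basis_fun 2))) f))" (is "?f2 has_fps_expansion ?F2")
proof -
  have ev: "eventually (\<lambda>b. ?f1 b = ip (kern_factor1 b) f \<and> ?f2 b = ip (kern_factor2 b) f) (nhds 0)"
    using eventually_small
  proof eventually_elim
    fix b :: complex assume b: "norm b * C < 1"
    define w :: "complex^'n::{finite,linorder}" where "w = axis i1 (cnj b)"
    have w: "w \<in> polydisc" using small_norm[OF b] by (simp add: w_def axis_in_polydisc)
    have P: "(\<Prod>i\<in>UNIV - {i1}. szego_power (lam i) (cnj (w $ i) * z $ i)) = 1" for z :: "complex^'n::{finite,linorder}"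
      by (rule prod.neutral) (auto simp: w_def axis_def)
    have "kern w (axis 1 1) = kern_factor1 b" "kern w (axis 2 1) = kern_factor2 b"
      unfolding kern_axis P by (simp_all add: w_def fun_eq_iff)
    thus "?f1 b = ip (kern_factor1 b) f \<and> ?f2 b = ip (kern_factor2 b) f"
      using reproducing_axis[OF w f, of 1] reproducing_axis[OF w f, of 2] ip_cnj[OF f kern_in_H[OF w]]
      by (metis w_def)
  qed
  have ip_kern_factor: "ip (kern_factor1 b) f = ip (\<lambda>z. szego_power (lam i1) (b * z $ i1) *s basis_fun 1 z) f +
       b * ip (\<lambda>z. szego_power (lam i1 + 1) (b * z $ i1) *s basis_fun 2 z) f"
     "ip (kern_factor2 b) f = ip (\<lambda>z. szego_power (lam i1 + 1) (b * z $ i1) *s T i1 (basis_fun 1) z) f +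
       (of_real kappa * ip (\<lambda>z. szego_power (lam i1 + 2) (b * z $ i1) *s basis_fun 2 z) f +
        b * ip (\<lambda>z. szego_power (lam i1 + 2) (b * z $ i1) *s T i1 (basis_fun 2) z) f)" if "norm b * C < 1" for b
    unfolding kern_factor1_def kern_factor2_def
    by (simp_all add: ip_add ip_scale add_in_H scale_in_H szego_power_mult_in_H that basis_fun_1_in_H basis_fun_2_in_H T_basis_fun_in_H f)
  have ev1: "eventually (\<lambda>b. ?f1 b = ip (\<lambda>z. szego_power (lam i1) (b * z $ i1) *s basis_fun 1 z) f +
       b * ip (\<lambda>z. szego_power (lam i1 + 1) (b * z $ i1) *s basis_fun 2 z) f) (nhds 0)"
    using ev eventually_small by eventually_elim (simp add: ip_kern_factor)
  have ev2: "eventually (\<lambda>b. ?f2 b = ip (\<lambda>z. szego_power (lam i1 + 1) (b * z $ i1) *s T i1 (basis_fun 1) z) f +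
       (of_real kappa * ip (\<lambda>z. szego_power (lam i1 + 2) (b * z $ i1) *s basis_fun 2 z) f +
        b * ip (\<lambda>z. szego_power (lam i1 + 2) (b * z $ i1) *s T i1 (basis_fun 2) z) f)) (nhds 0)"
    using ev eventually_small by eventually_elim (simp add: ip_kern_factor)
  show "?f1 has_fps_expansion ?F1"
    by (rule has_fps_expansion_transform[OF ev1]) (intro fps_expansion_intros ip_szego_power_expansion basis_fun_1_in_H basis_fun_2_in_H f)
  show "?f2 has_fps_expansion ?F2"
    by (rule has_fps_expansion_transform[OF ev2]) (intro fps_expansion_intros ip_szego_power_expansion basis_fun_2_in_H T_basis_fun_in_H f)
qed

lemma basis_fun_axis: "norm b < 1 \<Longrightarrow> basis_fun p (axis i b) $ r = (if r = p then 1 else 0)"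
  by (simp add: basis_fun_def axis_in_polydisc) (simp add: axis_def)

lemma eventually_norm_less_1: "eventually (\<lambda>b :: complex. norm b < 1) (nhds 0)"
  using eventually_nhds_in_open[of "ball 0 1" "0 :: complex"] by (auto elim: eventually_mono)

text \<open>Here \<open>f = (z\<^sub>1, 0)\<close>. The relations come from the linear coefficient of the first component
  and the constant coefficient of the second.\<close>
lemma T_basis_fun_1_relations:
  defines "f \<equiv> T i1 (basis_fun 1)"
  shows "of_real (lam i1) * ip f f + ip (basis_fun 2) f = 1" and "ip f f + of_real kappa * ip (basis_fun 2) f = 0"
proof -
  have f: "f \<in> H" unfolding f_def by (rule T_basis_fun_in_H)
  have "eventually (\<lambda>b. cnj (f (axis i1 (cnj b)) $ 1) = b) (nhds 0)"
    "eventually (\<lambda>b. cnj (f (axis i1 (cnj b)) $ 2) = 0) (nhds 0)"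
    by (rule eventually_mono[OF eventually_norm_less_1], simp add: f_def coordinate_mult_apply basis_fun_axis)+
  from this[THEN has_fps_expansion_transform]
  have 1: "(\<lambda>b. cnj (f (axis i1 (cnj b)) $ 1)) has_fps_expansion fps_X"
    and 2: "(\<lambda>b. cnj (f (axis i1 (cnj b)) $ 2)) has_fps_expansion 0"
    by (auto intro: fps_expansion_intros)
  note [simp] = fps_X_mult_nth
  show "of_real (lam i1) * ip f f + ip (basis_fun 2) f = 1"
    using arg_cong[OF has_fps_expansion_unique[OF component_expansions(1)[OF f] 1], of "\<lambda>F. fps_nth F 1"]
    by (simp add: f_def)
  show "ip f f + of_real kappa * ip (basis_fun 2) f = 0"
    using arg_cong[OF has_fps_expansion_unique[OF component_expansions(2)[OF f] 2], of "\<lambda>F. fps_nth F 0"]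
    by (simp add: f_def)
qed

text \<open>Here \<open>f = (z\<^sub>1\<^sup>2, kappa z\<^sub>1)\<close>. The first two relations come from the quadratic coefficient of the
  first component and the linear coefficient of the second; they determine the inner products of
  \<open>f\<close> with \<open>(z\<^sub>1\<^sup>2, 0)\<close> and \<open>(0, z\<^sub>1)\<close>.\<close>
lemma T_kern_axis2_relations:
  defines "f \<equiv> T i1 (kern 0 (axis 2 1))"
  shows "of_real (lam i1 * (lam i1 + 1)) / 2 * ip (T i1 (T i1 (basis_fun 1))) f
      + of_real (lam i1 + 1) * ip (T i1 (basis_fun 2)) f = 1"
    and "of_real (lam i1 + 1) * ip (T i1 (T i1 (basis_fun 1))) f
      + (of_real (kappa * (lam i1 + 2)) * ip (T i1 (basis_fun 2)) f + ip (T i1 (basis_fun 2)) f) = of_real kappa"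
    and "ip f f = ip (T i1 (T i1 (basis_fun 1))) f + of_real kappa * ip (T i1 (basis_fun 2)) f"
proof -
  have f: "f \<in> H" unfolding f_def by (intro mult_in_H kern_in_H zero_in_polydisc)
  have f_eq: "f = T i1 (T i1 (basis_fun 1)) + fscale (of_real kappa) (T i1 (basis_fun 2))"
    by (simp add: f_def kern_0_axis2 fun_eq_iff coordinate_mult_apply fscale_def vec_eq_iff algebra_simps)
  show "ip f f = ip (T i1 (T i1 (basis_fun 1))) f + of_real kappa * ip (T i1 (basis_fun 2)) f"
    by (subst (1) f_eq) (simp add: ip_add ip_scale scale_in_H mult_in_H basis_fun_1_in_H basis_fun_2_in_H f)
  have ev1: "eventually (\<lambda>b. cnj (f (axis i1 (cnj b)) $ 1) = b ^ 2) (nhds 0)"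
    and ev2: "eventually (\<lambda>b. cnj (f (axis i1 (cnj b)) $ 2) = of_real kappa * b) (nhds 0)"
    by (rule eventually_mono[OF eventually_norm_less_1],
        simp add: f_eq coordinate_mult_apply fscale_def basis_fun_axis power2_eq_square)+
  have 1: "(\<lambda>b. cnj (f (axis i1 (cnj b)) $ 1)) has_fps_expansion fps_X ^ 2"
    by (rule has_fps_expansion_transform[OF ev1]) (rule has_fps_expansion_fps_X_power)
  have 2: "(\<lambda>b. cnj (f (axis i1 (cnj b)) $ 2)) has_fps_expansion fps_const (of_real kappa) * fps_X"
    by (rule has_fps_expansion_transform[OF ev2]) (intro fps_expansion_intros)
  note [simp] = fps_X_mult_nth fps_X_power_nth
  show "of_real (lam i1 * (lam i1 + 1)) / 2 * ip (T i1 (T i1 (basis_fun 1))) f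
      + of_real (lam i1 + 1) * ip (T i1 (basis_fun 2)) f = 1"
    using arg_cong[OF has_fps_expansion_unique[OF component_expansions(1)[OF f] 1], of "\<lambda>F. fps_nth F 2"]
    by (simp add: numeral_2_eq_2 szego_coeff_simps(3)[unfolded numeral_2_eq_2])
  show "of_real (lam i1 + 1) * ip (T i1 (T i1 (basis_fun 1))) f
      + (of_real (kappa * (lam i1 + 2)) * ip (T i1 (basis_fun 2)) f + ip (T i1 (basis_fun 2)) f) = of_real kappa"
    using arg_cong[OF has_fps_expansion_unique[OF component_expansions(2)[OF f] 2], of "\<lambda>F. fps_nth F 1"]
    by (simp add: mult_ac)
qed

text \<open>The assumptions say that on the span of \<open>K(\<cdot>,0)e\<^sub>1\<close> and \<open>K(\<cdot>,0)e\<^sub>2\<close> the squared norms of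
  the images under \<open>T\<^sub>1\<close> are proportional to the squared norms \<open>1\<close> and \<open>kappa\<close> of these vectors.
  Eliminating the unknown inner products from the preceding relations leaves
  \<open>(\<lambda>\<^sub>1 \<kappa> - 1) ((\<lambda>\<^sub>1 + 1) \<kappa> - 1) = 0\<close>, but both factors are positive.\<close>
lemma norm_relations_contradiction:
  fixes l :: complex
  assumes 1: "l * ip (T i1 (basis_fun 1)) (T i1 (basis_fun 1)) = 1"
    and 2: "l * ip (T i1 (kern 0 (axis 2 1))) (T i1 (kern 0 (axis 2 1))) = of_real kappa"
  shows False
proof -
  define L A :: complex where "L = of_real (lam i1)" and "A = of_real kappa"
  define N1 where "N1 = ip (T i1 (basis_fun 1)) (T i1 (basis_fun 1))"
  define N2 where "N2 = ip (T i1 (kern 0 (axis 2 1))) (T i1 (kern 0 (axis 2 1)))"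
  define X where "X = ip (T i1 (T i1 (basis_fun 1))) (T i1 (kern 0 (axis 2 1)))"
  define Y where "Y = ip (T i1 (basis_fun 2)) (T i1 (kern 0 (axis 2 1)))"
  define Z where "Z = ip (basis_fun 2) (T i1 (basis_fun 1))"
  have A0: "A + 1 \<noteq> 0" "L * A - 1 \<noteq> 0" "(L + 1) * A \<noteq> 1"
  proof -
    have "A + 1 = of_real (kappa + 1)" "L * A - 1 = of_real (lam i1 * kappa - 1)"
      "(L + 1) * A - 1 = of_real ((lam i1 + 1) * kappa - 1)"
      by (simp_all add: L_def A_def)
    moreover have "kappa + 1 \<noteq> 0" "lam i1 * kappa - 1 \<noteq> 0" "(lam i1 + 1) * kappa - 1 \<noteq> 0"
      using kappa_pos lam_kappa lam_pos[of i1] by (auto simp: algebra_simps)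
    ultimately show "A + 1 \<noteq> 0" "L * A - 1 \<noteq> 0" "(L + 1) * A \<noteq> 1"
      by (metis of_real_eq_0_iff right_minus_eq)+
  qed
  have e1: "L * N1 + Z = 1" "N1 + A * Z = 0"
    using T_basis_fun_1_relations by (simp_all add: L_def A_def N1_def Z_def)
  have e2: "L * (L + 1) / 2 * X + (L + 1) * Y = 1" "(L + 1) * X + (A * (L + 2) * Y + Y) = A"
    "N2 = X + A * Y"
    using T_kern_axis2_relations by (simp_all add: L_def A_def N2_def X_def Y_def)
  have l: "l * N1 = 1" "l * N2 = A"
    using 1 2 by (simp_all add: N1_def N2_def A_def)
  have "l \<noteq> 0" using l by auto
  have N: "N2 = A * N1"
  proof -
    have "l * N2 = l * (A * N1)" using l by (simp add: mult.left_commute[of l A])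
    thus ?thesis using \<open>l \<noteq> 0\<close> by simp
  qed
  have N1: "(L * A - 1) * N1 = A" using e1 by algebra
  have "(A + 1) * ((L * A - 1) * Y + A) = 0" using e2 N N1 by algebra
  hence Y: "(L * A - 1) * Y = - A" using A0 by (simp add: eq_neg_iff_add_eq_0)
  have e2': "L * (L + 1) * X + 2 * (L + 1) * Y = 2" using e2(1) by (simp add: field_simps)
  have X: "(L * A - 1) * X = 2 * A * A" using e2(3) N N1 Y by algebra
  have "L * (L + 1) * ((L * A - 1) * X) + 2 * (L + 1) * ((L * A - 1) * Y) = 2 * (L * A - 1)"
    using arg_cong[OF e2', of "\<lambda>t. (L * A - 1) * t"] by (simp add: algebra_simps)
  hence "2 * (L * A - 1) * ((L + 1) * A - 1) = 0" unfolding X Y by algebra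
  thus False using A0 by simp
qed

text \<open>The preimage under \<open>U\<close> of a kernel function at \<open>0\<close> lies in the joint kernel of the adjoints, so it is
  again a kernel function at \<open>0\<close>, and the norm identity for the variable \<open>j\<close> is carried over
  to the first variable.\<close>
lemma not_unitarily_equivalent_to_transposed:
  assumes j: "j \<noteq> i1" and U: "bij_betw U H H" "\<And>x y. x \<in> H \<Longrightarrow> y \<in> H \<Longrightarrow> ip (U x) (U y) = ip x y"
    and intertw: "\<And>i x. x \<in> H \<Longrightarrow> U (T (Transposition.transpose i1 j i) x) = T i (U x)"
  shows False
proof -
  have UH: "U x \<in> H" if "x \<in> H" for x using U(1) that by (auto simp: bij_betw_def)
  have *: "of_real (lam j) * ip (T i1 (kern 0 \<eta>)) (T i1 (kern 0 \<eta>)) = ip (kern 0 \<eta>) (kern 0 \<eta>)" for \<eta>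
  proof -
    have k: "kern 0 \<eta> \<in> H" by (rule kern_in_H[OF zero_in_polydisc])
    then obtain x where x: "x \<in> H" "U x = kern 0 \<eta>" using U(1) by (metis bij_betw_def image_iff)
    have "x \<in> adjoint_kernel"
      unfolding adjoint_kernel_def
    proof (safe intro!: x)
      fix i f assume f: "f \<in> H"
      have "ip (T i f) x = ip (U (T i f)) (U x)" by (rule U(2)[OF mult_in_H[OF f] x(1), symmetric])
      also have "U (T i f) = T (Transposition.transpose i1 j i) (U f)"
        using intertw[OF f, of "Transposition.transpose i1 j i"] by simp
      also have "ip \<dots> (U x) = 0"
        using kern_0_in_adjoint_kernel UH[OF f] x(2) by (simp add: adjoint_kernel_def)
      finally show "ip (T i f) x = 0" .
    qed
    then obtain \<xi> where \<xi>: "x = kern 0 \<xi>" using adjoint_kernel_eq_kern_0 by blast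
    have "T i1 (kern 0 \<eta>) = U (T j x)" using intertw[OF x(1), of i1] x(2) by simp
    hence "ip (T i1 (kern 0 \<eta>)) (T i1 (kern 0 \<eta>)) = ip (T j x) (T j x)"
      using U(2) mult_in_H[OF x(1)] by simp
    moreover have "ip (kern 0 \<eta>) (kern 0 \<eta>) = ip x x"
      using U(2)[OF x(1) x(1)] x(2) by simp
    ultimately show ?thesis
      using norm_mult_kern_0_other_variable[OF j, of \<xi>] by (simp flip: \<xi>)
  qed
  have "ip (kern 0 (axis 1 1)) (kern 0 (axis 1 1)) = kern 0 (axis 1 1) 0 $ 1"
    by (rule reproducing_axis[OF zero_in_polydisc kern_in_H[OF zero_in_polydisc]])
  also have "\<dots> = 1"
    by (simp add: basis_fun_1_eq[symmetric]) (simp add: basis_fun_def zero_in_polydisc)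
  finally have "ip (kern 0 (axis 1 1)) (kern 0 (axis 1 1)) = 1" .
  moreover have "ip (kern 0 (axis 2 1)) (kern 0 (axis 2 1)) = of_real kappa"
    using reproducing_axis[OF zero_in_polydisc kern_in_H[OF zero_in_polydisc], of "axis 2 1" 2]
    by (simp add: kern_0_axis2 coordinate_mult_apply fscale_def basis_fun_def zero_in_polydisc)
  ultimately show False
    using norm_relations_contradiction[of "of_real (lam j)"] *[of "axis 1 1"] *[of "axis 2 1"]
    by (simp add: basis_fun_1_eq)
qed

end

section \<open>Non-homogeneity\<close>

theorem theorem6p4:
  fixes lam :: "'n::{finite,linorder} \<Rightarrow> real" and \<mu> :: real
    and H :: "(complex^'n::{finite,linorder} \<Rightarrow> complex^2) set"
    and ip :: "(complex^'n::{finite,linorder} \<Rightarrow> complex^2) \<Rightarrow> (complex^'n::{finite,linorder} \<Rightarrow> complex^2) \<Rightarrow> complex"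
  assumes "2 \<le> CARD('n)"
    and "\<And>i. 0 < lam i"
    and "0 < \<mu>"
    and "reproducing_kernel_space (tensor_kernel lam \<mu>) H ip"
  shows "\<not> complex_hilbert_space.homogeneous_tuple fscale H ip
            (coordinate_mult :: 'n \<Rightarrow> (complex^'n::{finite,linorder} \<Rightarrow> complex^2) \<Rightarrow> _)"
proof
  let ?T = "coordinate_mult :: 'n \<Rightarrow> (complex^'n::{finite,linorder} \<Rightarrow> complex^2) \<Rightarrow> _"
  interpret complex_hilbert_space fscale H ip
    using assms(4) by (simp add: reproducing_kernel_space_def)
  assume hom: "homogeneous_tuple ?T"
  hence bdd: "bounded_operator (?T i)" for i
    by (simp add: homogeneous_tuple_def commuting_tuple_def)
  obtain c where c: "\<And>i x. x \<in> H \<Longrightarrow> hnorm (?T i x) \<le> c i * hnorm x"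
    using bdd unfolding bounded_operator_def by metis
  define C where "C = 1 + (\<Sum>i\<in>UNIV. \<bar>c i\<bar>)"
  have C: "c i \<le> C" for i
    using member_le_sum[of i UNIV "\<lambda>i. \<bar>c i\<bar>"] by (simp add: C_def)
  interpret polydisc_tensor_module H ip lam \<mu> C
  proof
    show "1 \<le> C" by (simp add: C_def sum_nonneg)
    show "?T i f \<in> H" if "f \<in> H" for i f using bdd that by (simp add: bounded_operator_def)
    show "hnorm (?T i f) \<le> C * hnorm f" if "f \<in> H" for i f
      using c[OF that, of i] mult_right_mono[OF C hnorm_nonneg[OF that], of i] by linarith
  qed (use assms in auto)
  have "card (UNIV - {i1 :: 'n}) \<noteq> 0" using assms(1) by (simp add: card_Diff_singleton)
  then obtain j where j: "j \<noteq> i1" by (metis Diff_eq_empty_iff card.empty insertI1 subsetI singletonD DiffE all_not_in_conv)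
  obtain S where S: "\<And>i. functional_calculus (\<lambda>z. z $ Transposition.transpose i1 j i) ?T (S i)"
    and "unitarily_equivalent S ?T"
    using hom coordinate_permutation_in_aut_polydisc[of i1 j] unfolding homogeneous_tuple_def
    by fastforce
  then obtain U where U: "bij_betw U H H" "\<And>x y. x \<in> H \<Longrightarrow> y \<in> H \<Longrightarrow> ip (U x) (U y) = ip x y"
    "\<And>i x. x \<in> H \<Longrightarrow> U (S i x) = ?T i (U x)"
    unfolding unitarily_equivalent_def by blast
  \<comment> \<open>\<open>S\<close> is \<open>g(T)\<close> for the transposition \<open>g\<close>, hence multiplication by the permuted coordinates\<close>
  have "S i x = ?T (Transposition.transpose i1 j i) x" if x: "x \<in> H" for i x
  proof
    fix z
    have "S i x \<in> H" using S[of i] x by (simp add: functional_calculus_def)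
    thus "S i x z = ?T (Transposition.transpose i1 j i) x z"
      using functional_calculus_coordinate_mult[OF S x] x
      by (cases "z \<in> polydisc") (simp_all add: coordinate_mult_apply zero_outside)
  qed
  with U show False
    using not_unitarily_equivalent_to_transposed[OF j U(1,2)] by metis
qed

end
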